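(* A single-source-and-multiple-sink series parallel graph may have multiple equilibria: there exist such a graph $G$ (with source $s$ and sink set $T$), a production cost $a_s>0$ and market parameters $a_t>a_s$, $b_t>0$ ($t\in T$) for which the sequential decision game on $G$ has more than one equilibrium.
   Context: Graphs. A series parallel graph (SPG) with one source and one sink is a graph constructed from copies of the single-arc graph by series compositions (identify the sink of $X$ with the source of $Y$) and parallel compositions (identify the two sources and the two sinks). A single-source-and-multiple-sink SPG (SMSPG) is a graph obtained from an SPG by deleting its sink node and setting the nodes adjacent to that sink as the new sink nodes; $T$ denotes the set of sinks. Game. Let $s$ be the source and $V$ the set of remaining nodes (intermediary firms). An arc $ij$ means $i$ can sell to $j$; $B(i)=\{j: ij\in E\}$, $S(i)=\{k: ki\in E\}$. The production cost is $p_s=a_s>0$. The source moves first; each firm moves once all its sellers have moved, observing their decisions. Firm $i\in V$ chooses buying quantities $0\le x^{in}_{ki}\le x^{out}_{ki}$ ($k\in S(i)$), selling quantities $x^{out}_{ij}\ge 0$ and prices $p_{ij}\ge 0$ ($j\in B(i)$); the source chooses $x^{out}_{sj}\ge0$, $p_{sj}\ge0$. Each market $t\in T$ accepts everything ($x^{in}_{it}=x^{out}_{it}$) and prices on arcs into $t$ are not chosen but equal $p_t=a_t-b_tX_t$, $X_t=\sum_{i\in S(t)}x^{in}_{it}$. Firms obtain goods only from their sellers and get no value from retained goods. Payoffs: $\Pi_s=\sum_{j\in B(s)}p_{sj}x^{in}_{sj}-p_s\sum_{j\in B(s)}x^{out}_{sj}$ and $\Pi_i=\sum_{j\in B(i)}p_{ij}x^{in}_{ij}-\sum_{k\in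 S(i)}p_{ki}x^{in}_{ki}$ for $i\in V$. Equilibrium. A collection of strategies of all firms such that (1) $x^{in}_{ij}=x^{out}_{ij}$ for every arc $ij$; (2) no firm $i\in V\cup\{s\}$ can obtain a better payoff by changing its strategy, assuming each descendant firm of $i$ plays a best strategy maximizing its payoff and the strategies of non-descendants of $i$ stay the same. An arc is active if its equilibrium flow $x_{ij}=x^{in}_{ij}=x^{out}_{ij}$ is positive. Two equilibria are regarded as the same if they have the same set of active arcs and the same flow and price on each active arc; otherwise they are different. *)

theory Defs
  imports Complex_Main "HOL-Library.FuncSet" "Graph_Theory.Pair_Digraph"
begin

section \<open>Series parallel graphs\<close>

text \<open>
  \<open>spg G s t\<close>: \<open>G\<close> is a series parallel graph with source \<open>s\<close> and sink \<open>t\<close>.  Nodes are identified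
  by giving them the same name, so the two parts of a composition may share exactly the identified
  nodes; every arc with distinct ends is a copy of the single-arc graph.  An arc is the pair of its
  ends, hence parallel arcs created by a parallel composition are merged.
\<close>

inductive spg :: "'v pair_pre_digraph \<Rightarrow> 'v \<Rightarrow> 'v \<Rightarrow> bool" where
  single_arc: "u \<noteq> v \<Longrightarrow> spg \<lparr>pverts = {u, v}, parcs = {(u, v)}\<rparr> u v"
| series: "\<lbrakk>spg G s m; spg H m t; pverts G \<inter> pverts H = {m}\<rbrakk>
    \<Longrightarrow> spg \<lparr>pverts = pverts G \<union> pverts H, parcs = parcs G \<union> parcs H\<rparr> s t"
| parallel: "\<lbrakk>spg G s t; spg H s t; pverts G \<inter> pverts H = {s, t}\<rbrakk>
    \<Longrightarrow> spg \<lparr>pverts = pverts G \<union> pverts H, parcs = parcs G \<union> parcs H\<rparr> s t"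

definition smspg :: "'v pair_pre_digraph \<Rightarrow> 'v \<Rightarrow> 'v set \<Rightarrow> bool" where
  "smspg G s T \<longleftrightarrow> (\<exists>H t. spg H s t \<and>
     G = \<lparr>pverts = pverts H - {t}, parcs = {(i, j) \<in> parcs H. i \<noteq> t \<and> j \<noteq> t}\<rparr> \<and>
     T = {i. (i, t) \<in> parcs H})"

section \<open>The sequential game\<close>

text \<open>
  The decision of a firm \<open>i\<close>: \<open>buy k\<close> is the quantity bought on the arc \<open>ki\<close>, and \<open>sell j\<close>,
  \<open>price j\<close> are the quantity offered and the price asked on the arc \<open>ij\<close>.
\<close>

record 'v decision =
  buy :: "'v \<Rightarrow> real"
  sell :: "'v \<Rightarrow> real"
  price :: "'v \<Rightarrow> real"

type_synonym 'v profile = "'v \<Rightarrow> 'v decision"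

text \<open>
  A strategy is a contingent plan: it maps the observed decisions, i.e. a profile restricted to the
  ancestors of the firm (the firms that have necessarily moved before it), to a decision.
\<close>

type_synonym 'v strategy = "'v profile \<Rightarrow> 'v decision"

text \<open>
  \<open>a s\<close> is the unit production cost of the source; \<open>a t\<close> and \<open>b t\<close> are the intercept and the slope
  of the inverse demand in the market \<open>t \<in> T\<close>.
\<close>

locale trading_game =
  fixes G :: "'v pair_pre_digraph" and s :: 'v and T :: "'v set" and a b :: "'v \<Rightarrow> real"
begin

definition firms :: "'v set" where
  "firms = pverts G - T"

definition buyers :: "'v \<Rightarrow> 'v set" where
  "buyers i = {j. (i, j) \<in> parcs G}"

definition sellers :: "'v \<Rightarrow> 'v set" where
  "sellers i = {k. (k, i) \<in> parcs G}"

definition ancestors :: "'v \<Rightarrow> 'v set" where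
  "ancestors i = {k. k \<rightarrow>\<^sup>+\<^bsub>with_proj G\<^esub> i}"

text \<open>
  Entries of a decision that do not belong to a choice of the firm (absent arcs, prices on arcs
  into markets) are fixed to 0, so that they carry no information.  The last conjunct says that a
  firm other than the source has no goods but those bought from its sellers.
\<close>

definition feasible :: "'v profile \<Rightarrow> 'v \<Rightarrow> bool" where
  "feasible d i \<longleftrightarrow>
     (\<forall>k. if k \<in> sellers i then 0 \<le> buy (d i) k \<and> buy (d i) k \<le> sell (d k) i
          else buy (d i) k = 0) \<and>
     (\<forall>j. if j \<in> buyers i then 0 \<le> sell (d i) j else sell (d i) j = 0) \<and>
     (\<forall>j. if j \<in> buyers i - T then 0 \<le> price (d i) j else price (d i) j = 0) \<and>
     (i \<noteq> s \<longrightarrow> (\<Sum>j\<in>buyers i. sell (d i) j) \<le> (\<Sum>k\<in>sellers i. buy (d i) k))"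

definition x_out :: "'v profile \<Rightarrow> 'v \<Rightarrow> 'v \<Rightarrow> real" where
  "x_out d i j = sell (d i) j"

definition x_in :: "'v profile \<Rightarrow> 'v \<Rightarrow> 'v \<Rightarrow> real" where
  "x_in d i j = (if j \<in> T then x_out d i j else buy (d j) i)"

definition arc_price :: "'v profile \<Rightarrow> 'v \<Rightarrow> 'v \<Rightarrow> real" where
  "arc_price d i j =
     (if j \<in> T then a j - b j * (\<Sum>k\<in>sellers j. x_in d k j) else price (d i) j)"

definition payoff :: "'v profile \<Rightarrow> 'v \<Rightarrow> real" where
  "payoff d i = (\<Sum>j\<in>buyers i. arc_price d i j * x_in d i j) -
     (if i = s then a s * (\<Sum>j\<in>buyers s. x_out d s j)
      else (\<Sum>k\<in>sellers i. arc_price d k i * x_in d k i))"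

definition follows :: "('v \<Rightarrow> 'v strategy) \<Rightarrow> 'v profile \<Rightarrow> 'v \<Rightarrow> bool" where
  "follows \<sigma> d i \<longleftrightarrow> d i = \<sigma> i (restrict d (ancestors i))"

text \<open>
  Whatever feasible decisions the ancestors of \<open>i\<close> have made, the decision prescribed to \<open>i\<close> is
  feasible and no other feasible decision of \<open>i\<close> gives a better payoff, when the descendants of \<open>i\<close>
  react according to their strategies and the firms that are neither ancestors nor descendants of
  \<open>i\<close> stick to theirs.
\<close>

definition best_strategy :: "('v \<Rightarrow> 'v strategy) \<Rightarrow> 'v \<Rightarrow> bool" where
  "best_strategy \<sigma> i \<longleftrightarrow>
     (\<forall>d. (\<forall>k\<in>ancestors i. feasible d k) \<and> (\<forall>k\<in>firms - ancestors i. follows \<sigma> d k) \<longrightarrow>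
        feasible d i \<and>
        (\<forall>d'. (\<forall>k\<in>ancestors i. d' k = d k) \<and> feasible d' i \<and>
              (\<forall>k\<in>firms - ancestors i - {i}. follows \<sigma> d' k) \<longrightarrow>
           payoff d' i \<le> payoff d i))"

text \<open>
  \<open>\<sigma>\<close> is an equilibrium and \<open>d\<close> consists of the decisions made when it is played.  Since all firms
  have best strategies in the above sense, every firm that contemplates a change faces descendants
  that play best strategies against it.
\<close>

definition equilibrium :: "('v \<Rightarrow> 'v strategy) \<Rightarrow> 'v profile \<Rightarrow> bool" where
  "equilibrium \<sigma> d \<longleftrightarrow>
     (\<forall>i\<in>firms. follows \<sigma> d i) \<and>
     (\<forall>(i, j)\<in>parcs G. x_in d i j = x_out d i j) \<and>
     (\<forall>i\<in>firms. best_strategy \<sigma> i)"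

definition active_arcs :: "'v profile \<Rightarrow> ('v \<times> 'v) set" where
  "active_arcs d = {(i, j) \<in> parcs G. x_in d i j > 0}"

definition same_outcome :: "'v profile \<Rightarrow> 'v profile \<Rightarrow> bool" where
  "same_outcome d d' \<longleftrightarrow> active_arcs d = active_arcs d' \<and>
     (\<forall>(i, j)\<in>active_arcs d. x_in d i j = x_in d' i j \<and> arc_price d i j = arc_price d' i j)"

end

end

theory Submission
  imports Defs
begin

text \<open>
  A source \<open>0\<close> sells through one intermediary \<open>1\<close> to two markets \<open>2\<close>, \<open>3\<close> with different choke
  prices.  At price \<open>p\<close> the intermediary buys \<open>(4 - p)\<^sup>+ + 3 (2 - p)\<^sup>+\<close>: the demand faced by the source
  has a convex kink where the second market opens, so its profit has two local maxima, one serving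
  only market \<open>2\<close> (\<open>p = 5/2\<close>, quantity \<open>3/2\<close>) and one serving both (\<open>p = 7/4\<close>, quantity \<open>3\<close>).
  The parameters are tuned so that both give the source the profit \<open>9/4\<close>.
\<close>

section \<open>The graph and its markets\<close>

definition fork :: "nat pair_pre_digraph" where
  "fork = \<lparr>pverts = {0, 1, 2, 3}, parcs = {(0, 1), (1, 2), (1, 3)}\<rparr>"

definition fork_a :: "nat \<Rightarrow> real" where
  "fork_a = (\<lambda>_. 0)(0 := 1, 2 := 4, 3 := 2)"

definition fork_b :: "nat \<Rightarrow> real" where
  "fork_b = (\<lambda>_. 0)(2 := 1/2, 3 := 1/6)"

text \<open>An auxiliary sink \<open>4\<close> closes the fork: the arc from \<open>0\<close> to
  \<open>1\<close> in series with two parallel paths from \<open>1\<close> to \<open>4\<close>.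
  Deleting \<open>4\<close> turns \<open>2\<close> and \<open>3\<close> into sinks.\<close>

lemma smspg_fork: "smspg fork 0 {2, 3}"
proof -
  have path: "spg \<lparr>pverts = {1, k, 4}, parcs = {(1, k), (k, 4)}\<rparr> 1 4"
    if "k \<noteq> 1" "k \<noteq> 4" for k :: nat
    using spg.series[OF spg.single_arc[of 1 k] spg.single_arc[of k 4]] that
    by (simp add: insert_commute)
  have fan: "spg \<lparr>pverts = {1, 2, 3, 4}, parcs = {(1, 2), (2, 4), (1, 3), (3, 4)}\<rparr> (1::nat) 4"
    using spg.parallel[OF path[of 2] path[of 3]] by (simp add: insert_commute)
  have "spg \<lparr>pverts = {0, 1, 2, 3, 4}, parcs = {(0, 1), (1, 2), (2, 4), (1, 3), (3, 4)}\<rparr> (0::nat) 4"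
    using spg.series[OF spg.single_arc[of 0 1] fan] by (simp add: insert_commute)
  then show ?thesis
    unfolding smspg_def fork_def
    by (intro exI conjI) (assumption, auto)
qed

section \<open>Optimal quantities and prices\<close>

definition demand :: "real \<Rightarrow> real" where
  "demand p = max 0 (4 - p) + 3 * max 0 (2 - p)"

text \<open>
  The part of a total quantity \<open>X\<close> that goes to market \<open>2\<close>; above \<open>X = 2\<close> it equalizes the marginal
  revenues \<open>4 - y\<close> and \<open>2 - (X - y) / 3\<close>.
\<close>

definition share :: "real \<Rightarrow> real" where
  "share X = (if X \<le> 2 then X else (X + 6) / 4)"

definition revenue :: "real \<Rightarrow> real \<Rightarrow> real" where
  "revenue y z = (4 - y / 2) * y + (2 - z / 6) * z"

lemma demand_nonneg: "0 \<le> demand p"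
  by (simp add: demand_def)

lemma share_bounds: "0 \<le> X \<Longrightarrow> 0 \<le> share X \<and> share X \<le> X"
  by (simp add: share_def)

text \<open>Revenue is concave, so it lies below its tangent plane at the optimal split. There
  \<open>4 - share X\<close> serves as the multiplier for both markets: it equals both marginal
  revenues if X > 2, while for X \<le> 2 market \<open>3\<close> is unserved and its marginal
  revenue 2 is at most \<open>4 - share X\<close>.\<close>

lemma revenue_tangent:
  assumes "0 \<le> z"
  shows "revenue y z \<le> revenue (share X) (X - share X) + (4 - share X) * (y + z - X)"
proof -
  have tangent: "revenue y z \<le> revenue u v + (4 - u) * (y - u) + (2 - v / 3) * (z - v)" for u v
  proof -
    \<comment> \<open>Revenue is quadratic, so the gap is exactly its second-order term.\<close>
    have "revenue u v + (4 - u) * (y - u) + (2 - v / 3) * (z - v) - revenue y z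
        = (y - u)\<^sup>2 / 2 + (z - v)\<^sup>2 / 6"
      by (simp add: revenue_def field_simps power2_eq_square)
    moreover have "0 \<le> (y - u)\<^sup>2 / 2 + (z - v)\<^sup>2 / 6"
      by simp
    ultimately show ?thesis
      by linarith
  qed
  have "(2 - (X - share X) / 3) * (z - (X - share X)) \<le> (4 - share X) * (z - (X - share X))"
  proof (cases "X \<le> 2")
    case True
    then show ?thesis
      using assms by (simp add: share_def mult_right_mono)
  next
    case False
    then have "2 - (X - share X) / 3 = 4 - share X"
      by (simp add: share_def field_simps)
    then show ?thesis
      by (simp only:)
  qed
  moreover have "(4 - share X) * (y - share X) + (4 - share X) * (z - (X - share X))
      = (4 - share X) * (y + z - X)"
    by (simp add: algebra_simps)
  ultimately show ?thesis
    using tangent[of "share X" "X - share X"] by linarith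
qed

text \<open>By the tangent bound, only the sign of the marginal profit
  \<open>4 - share X - p\<close> against the deviation \<open>y + z - X\<close> matters:
  complementary slackness, according to whether the offer \<open>x\<close> binds.\<close>

lemma intermediary_optimum:
  assumes "0 \<le> p" "0 \<le> z" "0 \<le> y" "y + z \<le> q" "q \<le> x"
  defines "X \<equiv> min x (demand p)"
  shows "revenue y z - p * q \<le> revenue (share X) (X - share X) - p * X"
proof -
  have "(4 - share X - p) * (y + z - X) \<le> 0"
  proof (cases "x < demand p")
    case True
    then have "p \<le> 4 - share X"
      using assms by (auto simp: demand_def share_def max_def field_simps split: if_splits)
    then show ?thesis
      using True assms by (intro mult_nonneg_nonpos) auto
  next
    case False
    then have X: "X = demand p"
      by (simp add: X_def)
    show ?thesis
    proof (cases "p \<le> 4")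
      case True
      \<comment> \<open>Up to the choke price 4, \<open>demand\<close> inverts marginal
        revenue.\<close>
      then have "4 - share X - p = 0"
        unfolding X by (auto simp: demand_def share_def max_def field_simps)
      then show ?thesis
        by simp
    next
      case False
      then have "X = 0"
        by (simp add: X demand_def)
      then show ?thesis
        using False assms by (intro mult_nonpos_nonneg) (auto simp: share_def)
    qed
  qed
  \<comment> \<open>Goods bought but not resold only add cost.\<close>
  moreover have "p * (y + z) \<le> p * q"
    using assms by (simp add: mult_left_mono)
  ultimately show ?thesis
    using revenue_tangent[OF assms(2), of y X] by (simp add: algebra_simps)
qed

text \<open>Completing the square on each side of the kink at 2 gives parabolas with vertices 7/4
  and 5/2 and the same height 9/4.\<close>

lemma source_profit_le: "(p - 1) * demand p \<le> 9 / 4"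
proof -
  consider "p \<le> 2" | "2 \<le> p" "p \<le> 4" | "4 \<le> p"
    by linarith
  then show ?thesis
  proof cases
    case 1
    have "(p - 1) * demand p = 9 / 4 - (2 * p - 7 / 2)\<^sup>2"
      using 1 by (simp add: demand_def field_simps power2_eq_square)
    then show ?thesis
      by simp
  next
    case 2
    have "(p - 1) * demand p = 9 / 4 - (p - 5 / 2)\<^sup>2"
      using 2 by (simp add: demand_def field_simps power2_eq_square)
    then show ?thesis
      by simp
  next
    case 3
    then show ?thesis
      by (simp add: demand_def)
  qed
qed

lemma source_optimum:
  assumes "0 \<le> x"
  shows "p * min x (demand p) - x \<le> 9 / 4"
proof -
  \<comment> \<open>Unsold units still cost 1 each to produce.\<close>
  have "p * min x (demand p) - x \<le> (p - 1) * min x (demand p)"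
    by (simp add: algebra_simps)
  also have "\<dots> \<le> 9 / 4"
  proof (cases "1 \<le> p")
    case True
    then have "(p - 1) * min x (demand p) \<le> (p - 1) * demand p"
      by (intro mult_left_mono) auto
    then show ?thesis
      using source_profit_le[of p] by linarith
  next
    case False
    then have "(p - 1) * min x (demand p) \<le> 0"
      using assms demand_nonneg[of p] by (intro mult_nonpos_nonneg) auto
    then show ?thesis
      by linarith
  qed
  finally show ?thesis .
qed

section \<open>The game on the fork\<close>

interpretation fork: trading_game fork 0 "{2, 3}" fork_a fork_b .

lemma fork_buyers:
  "fork.buyers 0 = {1}" "fork.buyers (Suc 0) = {2, 3}" "fork.buyers 2 = {}" "fork.buyers 3 = {}"
  unfolding fork.buyers_def by (auto simp: fork_def)

lemma fork_sellers:
  "fork.sellers 0 = {}" "fork.sellers (Suc 0) = {0}" "fork.sellers 2 = {1}" "fork.sellers 3 = {1}"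
  unfolding fork.sellers_def by (auto simp: fork_def)

lemma fork_firms: "fork.firms = {0, 1}"
  unfolding fork.firms_def by (auto simp: fork_def)

lemma fork_ancestors: "fork.ancestors 0 = {}" "fork.ancestors (Suc 0) = {0}"
proof -
  \<comment> \<open>A longer path to \<open>1\<close> would have to enter \<open>0\<close>, which
    has no sellers.\<close>
  have arc: "(k, i) \<in> parcs fork" if "(k, i) \<in> (parcs fork)\<^sup>+" "i \<le> 1" for k i
    using that by (cases rule: trancl.cases) (auto simp: fork_def elim: trancl.cases)
  have "fork.ancestors i = {k. (k, i) \<in> (parcs fork)\<^sup>+}" for i
    by (simp add: fork.ancestors_def)
  then show "fork.ancestors 0 = {}" "fork.ancestors (Suc 0) = {0}"
    using arc by (fastforce simp: fork_def)+
qed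

lemma fork_payoff_source:
  "fork.payoff d 0 = price (d 0) 1 * buy (d 1) 0 - sell (d 0) 1"
  unfolding fork.payoff_def fork.arc_price_def fork.x_in_def fork.x_out_def fork_buyers
  by (simp add: fork_a_def)

lemma fork_payoff_intermediary:
  "fork.payoff d (Suc 0) = revenue (sell (d 1) 2) (sell (d 1) 3) - price (d 0) 1 * buy (d 1) 0"
  unfolding fork.payoff_def fork.arc_price_def fork.x_in_def fork.x_out_def fork_buyers fork_sellers
  by (simp add: fork_sellers fork_a_def fork_b_def revenue_def)

section \<open>Strategies and equilibria\<close>

definition source_offer :: "real \<Rightarrow> real \<Rightarrow> nat decision" where
  "source_offer p x = \<lparr>buy = \<lambda>_. 0, sell = (\<lambda>_. 0)(1 := x), price = (\<lambda>_. 0)(1 := p)\<rparr>"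

definition response :: "nat decision \<Rightarrow> nat decision" where
  "response e = (let X = min (sell e 1) (demand (price e 1)) in
     \<lparr>buy = (\<lambda>_. 0)(0 := X), sell = (\<lambda>_. 0)(2 := share X, 3 := X - share X), price = \<lambda>_. 0\<rparr>)"

text \<open>The intermediary's reply is the same for all \<open>p\<close> and \<open>x\<close>; the
  equilibria differ only in the source's offer.\<close>

definition plan :: "real \<Rightarrow> real \<Rightarrow> nat \<Rightarrow> nat strategy" where
  "plan p x i = (\<lambda>d. if i = 0 then source_offer p x else response (d 0))"

definition play :: "real \<Rightarrow> real \<Rightarrow> nat profile" where
  "play p x i = (if i = 0 then source_offer p x else response (source_offer p x))"

lemma follows_source: "fork.follows (plan p x) d 0 \<longleftrightarrow> d 0 = source_offer p x"
  by (simp add: fork.follows_def plan_def)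

lemma follows_intermediary: "fork.follows (plan p x) d (Suc 0) \<longleftrightarrow> d 1 = response (d 0)"
  by (simp add: fork.follows_def plan_def fork_ancestors)

lemma response_sel:
  fixes e :: "nat decision"
  defines "X \<equiv> min (sell e 1) (demand (price e 1))"
  shows "buy (response e) 0 = X" "sell (response e) 2 = share X"
    "sell (response e) 3 = X - share X"
  by (simp_all add: response_def X_def Let_def)

lemma feasible_source_D:
  "fork.feasible d 0 \<Longrightarrow> 0 \<le> sell (d 0) 1 \<and> 0 \<le> price (d 0) 1"
  by (auto simp: fork.feasible_def fork_buyers dest: spec[of _ "1::nat"])

lemma feasible_intermediary_D:
  assumes "fork.feasible d (Suc 0)"
  shows "0 \<le> sell (d 1) 2" "0 \<le> sell (d 1) 3" "sell (d 1) 2 + sell (d 1) 3 \<le> buy (d 1) 0"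
    "buy (d 1) 0 \<le> sell (d 0) 1"
  using assms
  by (auto simp: fork.feasible_def fork_buyers fork_sellers dest: spec[of _ "2::nat"]
      spec[of _ "3::nat"] spec[of _ "0::nat"])

lemma feasible_source_offer:
  "d 0 = source_offer p x \<Longrightarrow> 0 \<le> p \<Longrightarrow> 0 \<le> x \<Longrightarrow> fork.feasible d 0"
  by (simp add: fork.feasible_def fork_buyers fork_sellers source_offer_def)

lemma feasible_response:
  assumes "d 1 = response (d 0)" "0 \<le> sell (d 0) 1"
  shows "fork.feasible d (Suc 0)"
  using assms share_bounds[of "min (sell (d 0) 1) (demand (price (d 0) 1))"]
    demand_nonneg[of "price (d 0) 1"]
  by (simp add: fork.feasible_def fork_buyers fork_sellers response_def Let_def)

lemma best_strategy_intermediary: "fork.best_strategy (plan p x) 1"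
proof -
  have "fork.payoff d' 1 \<le> fork.payoff d 1"
    if "fork.feasible d 0" "d 1 = response (d 0)" "d' 0 = d 0" "fork.feasible d' 1" for d d'
    using that feasible_source_D[of d] feasible_intermediary_D[of d']
      intermediary_optimum[of "price (d 0) 1" "sell (d' 1) 3" "sell (d' 1) 2" "buy (d' 1) 0"
        "sell (d 0) 1"]
    by (simp add: fork_payoff_intermediary response_sel)
  moreover have "fork.feasible d 1" if "fork.feasible d 0" "d 1 = response (d 0)" for d
    using that feasible_source_D[of d] feasible_response[of d] by simp
  ultimately show ?thesis
    by (auto simp: fork.best_strategy_def fork_ancestors fork_firms follows_intermediary)
qed

text \<open>The offer attains the bound 9/4 of \<open>source_optimum\<close>, which limits every
  deviation answered by \<open>response\<close>.\<close>

lemma best_strategy_source: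
  assumes "0 \<le> p" "x = demand p" "(p - 1) * x = 9 / 4"
  shows "fork.best_strategy (plan p x) 0"
proof -
  have "fork.payoff d 0 = 9 / 4" if "d 0 = source_offer p x" "d 1 = response (d 0)" for d
    using that assms
    by (simp add: fork_payoff_source response_sel) (simp add: source_offer_def algebra_simps)
  moreover have "fork.payoff d 0 \<le> 9 / 4" if "fork.feasible d 0" "d 1 = response (d 0)" for d
    using that feasible_source_D[of d] source_optimum[of "sell (d 0) 1" "price (d 0) 1"]
    by (simp add: fork_payoff_source response_sel)
  ultimately have "fork.payoff d' 0 \<le> fork.payoff d 0"
    if "d 0 = source_offer p x" "d 1 = response (d 0)" "fork.feasible d' 0" "d' 1 = response (d' 0)"
    for d d'
    using that by metis
  then show ?thesis
    using assms(1,2) demand_nonneg[of p]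
    by (auto simp: fork.best_strategy_def fork_ancestors fork_firms follows_source
        follows_intermediary intro: feasible_source_offer)
qed

text \<open>Offering exactly \<open>demand p\<close> makes the intermediary buy it all, so the
  market on the arc from \<open>0\<close> to \<open>1\<close> clears.\<close>

lemma equilibrium_plan:
  assumes "0 \<le> p" "x = demand p" "(p - 1) * x = 9 / 4"
  shows "fork.equilibrium (plan p x) (play p x)"
proof -
  have "fork.x_in (play p x) i j = fork.x_out (play p x) i j" if "(i, j) \<in> parcs fork" for i j
    using that assms(2)
    by (auto simp: fork_def fork.x_in_def fork.x_out_def play_def response_sel)
      (simp add: source_offer_def)
  then show ?thesis
    using best_strategy_source[OF assms] best_strategy_intermediary
    by (auto simp: fork.equilibrium_def fork_firms follows_source follows_intermediary play_def)
qed

lemma flow_play: "x = demand p \<Longrightarrow> fork.x_in (play p x) 0 1 = x"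
  by (simp add: fork.x_in_def play_def response_sel) (simp add: source_offer_def)

theorem proposition5p2:
  shows "\<exists>(G :: nat pair_pre_digraph) s T (a :: nat \<Rightarrow> real) (b :: nat \<Rightarrow> real).
    smspg G s T \<and> s \<notin> T \<and> (\<forall>t\<in>T. trading_game.buyers G t = {}) \<and>
    a s > 0 \<and> (\<forall>t\<in>T. a t > a s \<and> b t > 0) \<and>
    (\<exists>\<sigma> d \<sigma>' d'. trading_game.equilibrium G s T a b \<sigma> d \<and>
       trading_game.equilibrium G s T a b \<sigma>' d' \<and>
       \<not> trading_game.same_outcome G T a b d d')"
proof -
  \<comment> \<open>The prices are the vertices of the two profit parabolas.\<close>
  have demand: "3 / 2 = demand (5 / 2)" "3 = demand (7 / 4)"
    by (simp_all add: demand_def)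
  have "fork.equilibrium (plan (5 / 2) (3 / 2)) (play (5 / 2) (3 / 2))"
    by (rule equilibrium_plan) (simp_all add: demand(1)[symmetric])
  moreover have "fork.equilibrium (plan (7 / 4) 3) (play (7 / 4) 3)"
    by (rule equilibrium_plan) (simp_all add: demand(2)[symmetric])
  moreover have "\<not> fork.same_outcome (play (5 / 2) (3 / 2)) (play (7 / 4) 3)"
  proof -
    \<comment> \<open>The arc out of the source already separates the outcomes: its flow is 3/2 in
      one and 3 in the other.\<close>
    have "(0, 1) \<in> fork.active_arcs (play (5 / 2) (3 / 2))"
      using flow_play[OF demand(1)] unfolding fork.active_arcs_def by (simp add: fork_def)
    moreover have "fork.x_in (play (5 / 2) (3 / 2)) 0 1 \<noteq> fork.x_in (play (7 / 4) 3) 0 1"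
      by (simp only: flow_play[OF demand(1)] flow_play[OF demand(2)])
    ultimately show ?thesis
      unfolding fork.same_outcome_def by blast
  qed
  ultimately have "\<exists>\<sigma> d \<sigma>' d'. fork.equilibrium \<sigma> d \<and> fork.equilibrium \<sigma>' d' \<and>
      \<not> fork.same_outcome d d'"
    by blast
  moreover have "\<forall>t\<in>{2, 3}. fork.buyers t = {}"
    by (simp add: fork_buyers)
  moreover have "fork_a 0 > 0" "\<forall>t\<in>{2, 3}. fork_a t > fork_a 0 \<and> fork_b t > 0"
    by (simp_all add: fork_a_def fork_b_def)
  moreover have "(0::nat) \<notin> {2, 3}"
    by simp
  ultimately show ?thesis
    using smspg_fork
    by (intro exI[of _ fork] exI[of _ "0::nat"] exI[of _ "{2, 3::nat}"] exI[of _ fork_a]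
        exI[of _ fork_b] conjI)
qed

end
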